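(* Let $A=[a_{x,y}]_{x,y\in\mathbb Z}$ be a doubly infinite hermitian matrix with complex entries, i.e. $a_{x,y}^*=a_{y,x}$ for all $x,y\in\mathbb Z$. Suppose that there exist an integer $n\ge 1$ and an exponent $\gamma\in[0,1)$ such that $$a_{x,x+z}=0\quad\text{for all } x\in\mathbb Z \text{ and all integers } z>n\langle x\rangle^{\gamma},$$ and $$\lim_{|x|\to+\infty}\frac{1}{\langle x\rangle^{1-\gamma}}\left(\sum_{y\in\mathbb Z}|a_{x,y}|\right)=0.$$ Then the operator $A:c_0(\mathbb Z)\to\ell_2(\mathbb Z)$ given by $(Af)_x:=\sum_{y\in\mathbb Z}a_{x,y}f_y$, $x\in\mathbb Z$, $f\in c_0(\mathbb Z)$, is essentially self-adjoint on $\ell_2(\mathbb Z)$.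
   Context: Here $a^*$ denotes the complex conjugate of $a\in\mathbb C$, and $\langle a\rangle:=(1+|a|^2)^{1/2}$. The space $\ell_2(\mathbb Z)$ is the complex Hilbert space of doubly infinite complex sequences $f=(f_x)_{x\in\mathbb Z}$ with $\|f\|_{\ell_2(\mathbb Z)}=\left(\sum_x|f_x|^2\right)^{1/2}<+\infty$, and $c_0(\mathbb Z)\subset\ell_2(\mathbb Z)$ denotes the subspace of compactly (finitely) supported sequences. The operator $A$ with domain $c_0(\mathbb Z)$ is symmetric and closable; essentially self-adjoint means that its closure $\bar A:D(\bar A)\to\ell_2(\mathbb Z)$ is self-adjoint. *)

theory Defs
  imports "HOL-Analysis.Analysis"
begin

definition jbracket :: "complex \<Rightarrow> real" where
  "jbracket a = sqrt (1 + (cmod a)\<^sup>2)"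

text \<open>The Hilbert space of square-summable sequences indexed by the integers is represented as a
  carrier set of functions. The inner product is antilinear in its first argument; its series
  converges absolutely for arguments in \<open>ell2\<close>.\<close>

definition ell2 :: "(int \<Rightarrow> complex) set" where
  "ell2 = {f. (\<lambda>x. (cmod (f x))\<^sup>2) summable_on UNIV}"

definition ell2_norm :: "(int \<Rightarrow> complex) \<Rightarrow> real" where
  "ell2_norm f = sqrt (\<Sum>\<^sub>\<infinity>x. (cmod (f x))\<^sup>2)"

definition ell2_inner :: "(int \<Rightarrow> complex) \<Rightarrow> (int \<Rightarrow> complex) \<Rightarrow> complex" where
  "ell2_inner f g = (\<Sum>\<^sub>\<infinity>x. cnj (f x) * g x)"

definition c0 :: "(int \<Rightarrow> complex) set" where
  "c0 = {f. finite {x. f x \<noteq> 0}}"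

definition ell2_dense :: "(int \<Rightarrow> complex) set \<Rightarrow> bool" where
  "ell2_dense D \<longleftrightarrow> D \<subseteq> ell2 \<and>
     (\<forall>f\<in>ell2. \<forall>\<epsilon>>0. \<exists>g\<in>D. ell2_norm (\<lambda>x. f x - g x) < \<epsilon>)"

text \<open>An unbounded operator is represented by its graph \<open>{(f, T f) | f \<in> D(T)}\<close>, so that its domain
  is the relational \<^const>\<open>Domain\<close> and equality of graphs is equality of operators, domains
  included.\<close>

type_synonym graph = "((int \<Rightarrow> complex) \<times> (int \<Rightarrow> complex)) set"

definition linear_operator :: "graph \<Rightarrow> bool" where
  "linear_operator T \<longleftrightarrow>
     T \<subseteq> ell2 \<times> ell2 \<and> single_valued T \<and> ((\<lambda>_. 0, \<lambda>_. 0) \<in> T) \<and>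
     (\<forall>f h f' h'. (f, h) \<in> T \<longrightarrow> (f', h') \<in> T \<longrightarrow>
        (\<lambda>x. f x + f' x, \<lambda>x. h x + h' x) \<in> T) \<and>
     (\<forall>c f h. (f, h) \<in> T \<longrightarrow> (\<lambda>x. c * f x, \<lambda>x. c * h x) \<in> T)"

definition symmetric_operator :: "graph \<Rightarrow> bool" where
  "symmetric_operator T \<longleftrightarrow> linear_operator T \<and> ell2_dense (Domain T) \<and>
     (\<forall>f h g k. (f, h) \<in> T \<longrightarrow> (g, k) \<in> T \<longrightarrow> ell2_inner h g = ell2_inner f k)"

definition graph_closure :: "graph \<Rightarrow> graph" where
  "graph_closure T = {(f, h). f \<in> ell2 \<and> h \<in> ell2 \<and>
     (\<exists>F H. (\<forall>k::nat. (F k, H k) \<in> T) \<and>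
        (\<lambda>k. ell2_norm (\<lambda>x. F k x - f x)) \<longlonglongrightarrow> 0 \<and>
        (\<lambda>k. ell2_norm (\<lambda>x. H k x - h x)) \<longlonglongrightarrow> 0)}"

definition closable :: "graph \<Rightarrow> bool" where
  "closable T \<longleftrightarrow> linear_operator T \<and> single_valued (graph_closure T)"

text \<open>For densely defined \<open>T\<close>, this is the graph of the Hilbert space adjoint: \<open>g\<close> is in its domain
  iff there is \<open>k\<close> with \<open>\<langle>T f, g\<rangle> = \<langle>f, k\<rangle>\<close> for all \<open>f \<in> D(T)\<close>, and \<open>k\<close> is then unique.\<close>

definition adjoint_graph :: "graph \<Rightarrow> graph" where
  "adjoint_graph T = {(g, k). g \<in> ell2 \<and> k \<in> ell2 \<and>
     (\<forall>f h. (f, h) \<in> T \<longrightarrow> ell2_inner h g = ell2_inner f k)}"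

definition self_adjoint :: "graph \<Rightarrow> bool" where
  "self_adjoint T \<longleftrightarrow> linear_operator T \<and> ell2_dense (Domain T) \<and> adjoint_graph T = T"

definition essentially_self_adjoint :: "graph \<Rightarrow> bool" where
  "essentially_self_adjoint T \<longleftrightarrow>
     symmetric_operator T \<and> closable T \<and> self_adjoint (graph_closure T)"

text \<open>For \<open>f \<in> c0\<close> the series defining \<open>A f\<close> has only finitely many nonzero terms. That \<open>A f\<close> lies in
  \<open>ell2\<close> is not built in here; it is part of \<open>linear_operator\<close>.\<close>

definition matrix_operator :: "(int \<Rightarrow> int \<Rightarrow> complex) \<Rightarrow> graph" where
  "matrix_operator a = {(f, \<lambda>x. \<Sum>\<^sub>\<infinity>y. a x y * f y) | f. f \<in> c0}"

definition hermitian :: "(int \<Rightarrow> int \<Rightarrow> complex) \<Rightarrow> bool" where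
  "hermitian a \<longleftrightarrow> (\<forall>x y. cnj (a x y) = a y x)"

end

theory Submission
  imports Defs
begin

text \<open>Hermiticity and the one-sided band condition bound \<open>\<bar>x - y\<bar>\<close> by \<open>K * jbracket x powr \<gamma>\<close> whenever
  \<open>a x y \<noteq> 0\<close>, so rows are finite and the adjoint acts on its maximal domain. A pair \<open>(g, A g)\<close> in the
  adjoint is approximated by \<open>(u g, A (u g))\<close> with the tent cutoff \<open>u x = max 0 (1 - \<bar>x\<bar> / R)\<close>. The row
  sums of the commutator of \<open>A\<close> and \<open>u\<close> are at most \<open>K / R * jbracket x powr \<gamma>\<close> times those of \<open>A\<close>;
  by the growth hypothesis they tend to 0 uniformly in \<open>x\<close> as \<open>R\<close> grows, and the Schur test makes the
  commutator tend to 0 in operator norm. Hence the closure is the adjoint.\<close>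

section \<open>The space of square-summable sequences\<close>

text \<open>A series of nonnegative terms is the supremum of its finite partial sums. Membership and
  norm bounds thus reduce to \<open>L2_set\<close>, where Minkowski and Cauchy-Schwarz are available
  for finite sets.\<close>

lemma ell2I:
  assumes "\<And>F. finite F \<Longrightarrow> L2_set (\<lambda>x. cmod (f x)) F \<le> c"
  shows "f \<in> ell2" and "ell2_norm f \<le> c"
proof -
  have c: "c \<ge> 0"
    using assms[of "{}"] by simp
  have le: "(\<Sum>x\<in>F. (cmod (f x))\<^sup>2) \<le> c\<^sup>2" if "finite F" for F
    using assms[OF that] c by (simp add: L2_set_def sqrt_le_D)
  show mem: "f \<in> ell2"
    unfolding ell2_def mem_Collect_eq
    by (rule nonneg_bdd_above_summable_on) (use le in \<open>auto simp: bdd_above_def\<close>)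
  have "(\<Sum>\<^sub>\<infinity>x. (cmod (f x))\<^sup>2) \<le> c\<^sup>2"
    using mem le by (intro infsum_le_finite_sums) (auto simp: ell2_def)
  then show "ell2_norm f \<le> c"
    using c by (simp add: ell2_norm_def real_le_lsqrt)
qed

lemma L2_set_le_ell2_norm:
  assumes "f \<in> ell2" and "finite F"
  shows "L2_set (\<lambda>x. cmod (f x)) F \<le> ell2_norm f"
  using assms unfolding L2_set_def ell2_norm_def ell2_def
  by (auto intro!: real_sqrt_le_mono finite_sum_le_infsum)

lemma ell2_norm_nonneg [simp]: "ell2_norm f \<ge> 0"
  by (simp add: ell2_norm_def infsum_nonneg)

lemma norm_le_ell2_norm:
  assumes "f \<in> ell2"
  shows "cmod (f x) \<le> ell2_norm f"
  using L2_set_le_ell2_norm[OF assms, of "{x}"] by simp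

lemma ell2_add:
  assumes "f \<in> ell2" and "g \<in> ell2"
  shows "(\<lambda>x. f x + g x) \<in> ell2" and "ell2_norm (\<lambda>x. f x + g x) \<le> ell2_norm f + ell2_norm g"
proof -
  have "L2_set (\<lambda>x. cmod (f x + g x)) F \<le> ell2_norm f + ell2_norm g" if "finite F" for F
  proof -
    have "L2_set (\<lambda>x. cmod (f x + g x)) F \<le> L2_set (\<lambda>x. cmod (f x) + cmod (g x)) F"
      by (intro L2_set_mono) (auto intro: norm_triangle_ineq)
    also have "\<dots> \<le> L2_set (\<lambda>x. cmod (f x)) F + L2_set (\<lambda>x. cmod (g x)) F"
      by (rule L2_set_triangle_ineq)
    finally show ?thesis
      using L2_set_le_ell2_norm[OF assms(1) that] L2_set_le_ell2_norm[OF assms(2) that] by linarith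
  qed
  then show "(\<lambda>x. f x + g x) \<in> ell2" "ell2_norm (\<lambda>x. f x + g x) \<le> ell2_norm f + ell2_norm g"
    by (fact ell2I)+
qed

lemma ell2_bounded_mult:
  assumes "f \<in> ell2" and "\<And>x. cmod (u x) \<le> C"
  shows "(\<lambda>x. u x * f x) \<in> ell2"
proof (rule ell2I)
  fix F :: "int set"
  assume "finite F"
  have C: "0 \<le> C"
    using assms(2)[of 0] norm_ge_zero order_trans by blast
  have "L2_set (\<lambda>x. cmod (u x * f x)) F \<le> L2_set (\<lambda>x. C * cmod (f x)) F"
    by (intro L2_set_mono) (auto simp: norm_mult intro: mult_right_mono assms)
  also have "\<dots> = C * L2_set (\<lambda>x. cmod (f x)) F"
    using C by (simp add: L2_set_right_distrib)
  also have "\<dots> \<le> C * ell2_norm f"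
    using C by (intro mult_left_mono L2_set_le_ell2_norm assms \<open>finite F\<close>)
  finally show "L2_set (\<lambda>x. cmod (u x * f x)) F \<le> C * ell2_norm f" .
qed

lemma ell2_scale: "f \<in> ell2 \<Longrightarrow> (\<lambda>x. c * f x) \<in> ell2"
  by (rule ell2_bounded_mult) auto

lemma ell2_diff:
  assumes "f \<in> ell2" and "g \<in> ell2"
  shows "(\<lambda>x. f x - g x) \<in> ell2"
  using ell2_add(1)[OF assms(1) ell2_scale[OF assms(2), of "-1"]] by simp

lemma c0_subset_ell2: "c0 \<subseteq> ell2"
proof
  fix f assume "f \<in> c0"
  then show "f \<in> ell2"
    unfolding c0_def ell2_def by (simp add: finite_nonzero_values_imp_summable_on)
qed

text \<open>The summability half guarantees that \<open>ell2_inner\<close> is a genuine series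
  rather than the default value 0 of \<open>infsum\<close>, which is what additivity of the inner
  product rests on.\<close>

lemma ell2_cauchy_schwarz:
  assumes "f \<in> ell2" and "g \<in> ell2"
  shows "(\<lambda>x. cmod (cnj (f x) * g x)) summable_on UNIV"
    and "cmod (ell2_inner f g) \<le> ell2_norm f * ell2_norm g"
proof -
  have le: "(\<Sum>x\<in>F. cmod (cnj (f x) * g x)) \<le> ell2_norm f * ell2_norm g" if "finite F" for F
  proof -
    have "(\<Sum>x\<in>F. cmod (cnj (f x) * g x)) \<le> L2_set (\<lambda>x. cmod (f x)) F * L2_set (\<lambda>x. cmod (g x)) F"
      using L2_set_mult_ineq[of "\<lambda>x. cmod (f x)" "\<lambda>x. cmod (g x)" F] by (simp add: norm_mult)
    also have "\<dots> \<le> ell2_norm f * ell2_norm g"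
      by (intro mult_mono L2_set_le_ell2_norm assms that) auto
    finally show ?thesis .
  qed
  show summable: "(\<lambda>x. cmod (cnj (f x) * g x)) summable_on UNIV"
    by (rule nonneg_bdd_above_summable_on) (use le in \<open>auto simp: bdd_above_def\<close>)
  have "cmod (ell2_inner f g) \<le> (\<Sum>\<^sub>\<infinity>x. cmod (cnj (f x) * g x))"
    unfolding ell2_inner_def by (rule Infinite_Sum.norm_infsum_bound[OF summable])
  also have "\<dots> \<le> ell2_norm f * ell2_norm g"
    by (rule infsum_le_finite_sums[OF summable le])
  finally show "cmod (ell2_inner f g) \<le> ell2_norm f * ell2_norm g" .
qed

lemma ell2_inner_diff_left:
  assumes "f \<in> ell2" "f' \<in> ell2" "g \<in> ell2"
  shows "ell2_inner (\<lambda>x. f x - f' x) g = ell2_inner f g - ell2_inner f' g"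
proof -
  have "ell2_inner (\<lambda>x. f x - f' x) g = (\<Sum>\<^sub>\<infinity>x. cnj (f x) * g x + - (cnj (f' x) * g x))"
    by (simp add: ell2_inner_def algebra_simps)
  also have "\<dots> = ell2_inner f g - ell2_inner f' g"
    unfolding ell2_inner_def
    using assms
    by (subst infsum_add)
      (auto intro: Infinite_Sum.abs_summable_summable ell2_cauchy_schwarz
        simp: infsum_uminus summable_on_uminus)
  finally show ?thesis .
qed

lemma tendsto_ell2_inner_left:
  assumes "\<And>k. F k \<in> ell2" "f \<in> ell2" "g \<in> ell2"
    and "(\<lambda>k::nat. ell2_norm (\<lambda>x. F k x - f x)) \<longlonglongrightarrow> 0"
  shows "(\<lambda>k. ell2_inner (F k) g) \<longlonglongrightarrow> ell2_inner f g"
proof (rule LIM_zero_cancel, rule tendsto_0_le[where K = "ell2_norm g"])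
  show "(\<lambda>k. ell2_norm (\<lambda>x. F k x - f x)) \<longlonglongrightarrow> 0" by fact
  show "\<forall>\<^sub>F k in sequentially. norm (ell2_inner (F k) g - ell2_inner f g)
      \<le> norm (ell2_norm (\<lambda>x. F k x - f x)) * ell2_norm g"
    using ell2_cauchy_schwarz(2)[OF ell2_diff] assms
    by (intro always_eventually allI) (simp flip: ell2_inner_diff_left)
qed

lemma tendsto_ell2_pointwise:
  assumes "\<And>k. F k \<in> ell2" "f \<in> ell2"
    and "(\<lambda>k::nat. ell2_norm (\<lambda>x. F k x - f x)) \<longlonglongrightarrow> 0"
  shows "(\<lambda>k. F k x) \<longlonglongrightarrow> f x"
proof (rule LIM_zero_cancel, rule tendsto_0_le[where K = 1])
  show "(\<lambda>k. ell2_norm (\<lambda>x. F k x - f x)) \<longlonglongrightarrow> 0" by fact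
  show "\<forall>\<^sub>F k in sequentially. norm (F k x - f x) \<le> norm (ell2_norm (\<lambda>x. F k x - f x)) * 1"
    using norm_le_ell2_norm[OF ell2_diff[OF assms(1,2)]]
    by (intro always_eventually allI) simp
qed

text \<open>Dominated convergence: a finite set \<open>F\<close> carries nearly all of the mass of
  \<open>g\<close>. On \<open>F\<close> pointwise convergence of \<open>u k\<close> suffices, and
  off \<open>F\<close> the factor \<open>u k x - 1\<close> has modulus at most 2.\<close>

lemma ell2_norm_multiplier_tendsto_0:
  fixes u :: "nat \<Rightarrow> int \<Rightarrow> complex"
  assumes g: "g \<in> ell2" and u: "\<And>k x. cmod (u k x) \<le> 1" and lim: "\<And>x. (\<lambda>k. u k x) \<longlonglongrightarrow> 1"
  shows "(\<lambda>k. ell2_norm (\<lambda>x. u k x * g x - g x)) \<longlonglongrightarrow> 0"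
proof (rule LIMSEQ_I)
  fix \<epsilon> :: real
  assume "\<epsilon> > 0"
  define N where "N = (\<Sum>\<^sub>\<infinity>x. (cmod (g x))\<^sup>2)"
  have summ: "(\<lambda>x. (cmod (g x))\<^sup>2) summable_on UNIV"
    using g by (simp add: ell2_def)
  \<comment> \<open>The tail enters with the factor 4 = 2 * 2, so two tolerances of a tenth give
    1/10 + 4/10 = 1/2 of the squared target, which leaves room for a strict inequality.\<close>
  obtain F where F: "finite F" "dist (\<Sum>x\<in>F. (cmod (g x))\<^sup>2) N \<le> \<epsilon>\<^sup>2 / 10"
    using infsum_finite_approximation[OF summ, of "\<epsilon>\<^sup>2 / 10"] \<open>\<epsilon> > 0\<close> by (auto simp: N_def)
  define p where "p k = (\<Sum>x\<in>F. (cmod ((u k x - 1) * g x))\<^sup>2)" for k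
  have "p \<longlonglongrightarrow> (\<Sum>x\<in>F. (cmod ((1 - 1) * g x))\<^sup>2)"
    unfolding p_def by (intro tendsto_intros lim)
  then have "p \<longlonglongrightarrow> 0"
    by simp
  then have "\<forall>\<^sub>F k in sequentially. p k < \<epsilon>\<^sup>2 / 10"
    using \<open>\<epsilon> > 0\<close> by (intro order_tendstoD) auto
  moreover have "ell2_norm (\<lambda>x. u k x * g x - g x) < \<epsilon>" if k: "p k < \<epsilon>\<^sup>2 / 10" for k
  proof -
    have "L2_set (\<lambda>x. cmod (u k x * g x - g x)) G \<le> sqrt (\<epsilon>\<^sup>2 / 2)" if "finite G" for G
      unfolding L2_set_def
    proof (rule real_sqrt_le_mono)
      have far: "(cmod ((u k x - 1) * g x))\<^sup>2 \<le> 4 * (cmod (g x))\<^sup>2" for x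
      proof -
        have "cmod (u k x - 1) \<le> 2"
          using norm_triangle_ineq4[of "u k x" 1] u[of k x] by simp
        then have "(cmod ((u k x - 1) * g x))\<^sup>2 \<le> (2 * cmod (g x))\<^sup>2"
          by (intro power_mono) (auto simp: norm_mult intro: mult_right_mono)
        then show ?thesis by (simp add: power_mult_distrib)
      qed
      have "(\<Sum>x\<in>G. (cmod (u k x * g x - g x))\<^sup>2) = (\<Sum>x\<in>G. (cmod ((u k x - 1) * g x))\<^sup>2)"
        by (simp add: algebra_simps)
      also have "\<dots> \<le> (\<Sum>x\<in>F \<union> G. (cmod ((u k x - 1) * g x))\<^sup>2)"
        using F that by (intro sum_mono2) auto
      also have "\<dots> = p k + (\<Sum>x\<in>G - F. (cmod ((u k x - 1) * g x))\<^sup>2)"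
        unfolding p_def using F that
        by (subst Un_Diff_cancel[symmetric], intro sum.union_disjoint) auto
      also have "(\<Sum>x\<in>G - F. (cmod ((u k x - 1) * g x))\<^sup>2) \<le> 4 * (\<Sum>x\<in>G - F. (cmod (g x))\<^sup>2)"
        unfolding sum_distrib_left by (intro sum_mono far)
      also have "(\<Sum>x\<in>G - F. (cmod (g x))\<^sup>2) = (\<Sum>x\<in>F \<union> G. (cmod (g x))\<^sup>2) - (\<Sum>x\<in>F. (cmod (g x))\<^sup>2)"
        using sum.union_disjoint[of F "G - F" "\<lambda>x. (cmod (g x))\<^sup>2"] F that by (simp add: Un_Diff_cancel)
      also have "(\<Sum>x\<in>F \<union> G. (cmod (g x))\<^sup>2) \<le> N"
        unfolding N_def using summ F that by (intro finite_sum_le_infsum) auto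
      finally have "(\<Sum>x\<in>G. (cmod (u k x * g x - g x))\<^sup>2) \<le> p k + 4 * (N - (\<Sum>x\<in>F. (cmod (g x))\<^sup>2))"
        by simp
      then show "(\<Sum>x\<in>G. (cmod (u k x * g x - g x))\<^sup>2) \<le> \<epsilon>\<^sup>2 / 2"
        using k abs_le_D2[OF F(2)[unfolded dist_real_def]] by argo
    qed
    from ell2I(2)[OF this] have "ell2_norm (\<lambda>x. u k x * g x - g x) \<le> sqrt (\<epsilon>\<^sup>2 / 2)" .
    also have "\<dots> < \<epsilon>"
      using \<open>\<epsilon> > 0\<close> by (intro real_less_lsqrt) auto
    finally show ?thesis .
  qed
  ultimately have "\<forall>\<^sub>F k in sequentially. ell2_norm (\<lambda>x. u k x * g x - g x) < \<epsilon>"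
    by (rule eventually_mono)
  then show "\<exists>m. \<forall>k\<ge>m. norm (ell2_norm (\<lambda>x. u k x * g x - g x) - 0) < \<epsilon>"
    by (simp add: eventually_sequentially)
qed

text \<open>Sharp truncations already approximate in norm. Allowing any \<open>D\<close> above
  \<open>c0\<close> covers the domains of both the matrix operator and its closure.\<close>

lemma ell2_dense_c0:
  assumes "c0 \<subseteq> D" and "D \<subseteq> ell2"
  shows "ell2_dense D"
  unfolding ell2_dense_def
proof (intro conjI ballI allI impI)
  fix f and \<epsilon> :: real
  assume "f \<in> ell2" and "\<epsilon> > 0"
  define u :: "nat \<Rightarrow> int \<Rightarrow> complex" where "u k x = (if \<bar>x\<bar> \<le> int k then 1 else 0)" for k x
  have "(\<lambda>k. u k x) \<longlonglongrightarrow> 1" for x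
    by (rule tendsto_eventually, rule eventually_mono[OF eventually_ge_at_top[of "nat \<bar>x\<bar>"]])
      (simp add: u_def)
  then have "(\<lambda>k. ell2_norm (\<lambda>x. u k x * f x - f x)) \<longlonglongrightarrow> 0"
    using \<open>f \<in> ell2\<close> by (intro ell2_norm_multiplier_tendsto_0) (auto simp: u_def)
  then obtain k where k: "ell2_norm (\<lambda>x. u k x * f x - f x) < \<epsilon>"
    using order_tendstoD(2)[OF _ \<open>\<epsilon> > 0\<close>] eventually_happens trivial_limit_sequentially by blast
  have "ell2_norm (\<lambda>x. f x - u k x * f x) = ell2_norm (\<lambda>x. u k x * f x - f x)"
    by (simp add: ell2_norm_def norm_minus_commute)
  moreover have "(\<lambda>x. u k x * f x) \<in> c0"
    unfolding c0_def mem_Collect_eq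
    by (rule finite_subset[of _ "{- int k..int k}"]) (auto simp: u_def split: if_splits)
  ultimately show "\<exists>g\<in>D. ell2_norm (\<lambda>x. f x - g x) < \<epsilon>"
    using k assms(1) by (intro bexI[of _ "\<lambda>x. u k x * f x"]) auto
qed fact

text \<open>Write each \<open>cmod (c x y)\<close> as a product of two square roots. Cauchy-Schwarz
  in \<open>y\<close> consumes the row sums, and interchanging the two sums then consumes the column
  sums.\<close>

lemma schur_test_finite:
  fixes c :: "'a \<Rightarrow> 'b \<Rightarrow> complex"
  assumes row: "\<And>x. x \<in> F \<Longrightarrow> (\<Sum>y\<in>G. cmod (c x y)) \<le> \<epsilon>"
    and col: "\<And>y. y \<in> G \<Longrightarrow> (\<Sum>x\<in>F. cmod (c x y)) \<le> \<epsilon>"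
    and "\<epsilon> \<ge> 0"
  shows "L2_set (\<lambda>x. cmod (\<Sum>y\<in>G. c x y * g y)) F \<le> \<epsilon> * L2_set (\<lambda>y. cmod (g y)) G"
proof -
  have row_bound: "(cmod (\<Sum>y\<in>G. c x y * g y))\<^sup>2 \<le> \<epsilon> * (\<Sum>y\<in>G. cmod (c x y) * (cmod (g y))\<^sup>2)"
    if "x \<in> F" for x
  proof -
    have "cmod (\<Sum>y\<in>G. c x y * g y)
        \<le> (\<Sum>y\<in>G. \<bar>sqrt (cmod (c x y))\<bar> * \<bar>sqrt (cmod (c x y)) * cmod (g y)\<bar>)"
      by (rule order_trans[OF norm_sum])
        (simp add: norm_mult abs_mult flip: mult.assoc)
    also have "\<dots> \<le> L2_set (\<lambda>y. sqrt (cmod (c x y))) G * L2_set (\<lambda>y. sqrt (cmod (c x y)) * cmod (g y)) G"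
      by (rule L2_set_mult_ineq)
    finally have "(cmod (\<Sum>y\<in>G. c x y * g y))\<^sup>2
        \<le> (L2_set (\<lambda>y. sqrt (cmod (c x y))) G * L2_set (\<lambda>y. sqrt (cmod (c x y)) * cmod (g y)) G)\<^sup>2"
      by (intro power_mono) auto
    also have "\<dots> = (\<Sum>y\<in>G. cmod (c x y)) * (\<Sum>y\<in>G. cmod (c x y) * (cmod (g y))\<^sup>2)"
      by (simp add: L2_set_def power_mult_distrib sum_nonneg)
    also have "\<dots> \<le> \<epsilon> * (\<Sum>y\<in>G. cmod (c x y) * (cmod (g y))\<^sup>2)"
      by (intro mult_right_mono row that sum_nonneg) auto
    finally show ?thesis .
  qed
  have "(\<Sum>x\<in>F. (cmod (\<Sum>y\<in>G. c x y * g y))\<^sup>2)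
      \<le> (\<Sum>x\<in>F. \<epsilon> * (\<Sum>y\<in>G. cmod (c x y) * (cmod (g y))\<^sup>2))"
    by (intro sum_mono row_bound)
  also have "\<dots> = \<epsilon> * (\<Sum>y\<in>G. (\<Sum>x\<in>F. cmod (c x y)) * (cmod (g y))\<^sup>2)"
    unfolding sum_distrib_right by (subst sum.swap) (simp add: sum_distrib_left)
  also have "\<dots> \<le> \<epsilon> * (\<Sum>y\<in>G. \<epsilon> * (cmod (g y))\<^sup>2)"
    by (intro mult_left_mono sum_mono mult_right_mono col assms) auto
  also have "\<dots> = \<epsilon>\<^sup>2 * (\<Sum>y\<in>G. (cmod (g y))\<^sup>2)"
    by (simp add: power2_eq_square sum_distrib_left mult.assoc)
  finally have "sqrt (\<Sum>x\<in>F. (cmod (\<Sum>y\<in>G. c x y * g y))\<^sup>2) \<le> sqrt (\<epsilon>\<^sup>2 * (\<Sum>y\<in>G. (cmod (g y))\<^sup>2))"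
    by (rule real_sqrt_le_mono)
  then show ?thesis
    using assms(3) by (simp add: L2_set_def real_sqrt_mult)
qed

section \<open>Graphs and adjoints\<close>

text \<open>In the defining identity of the adjoint both \<open>f\<close> and \<open>h\<close> stand
  in the left slot of the inner product, so continuity in that slot carries the identity to limits
  of graph elements.\<close>

lemma adjoint_graph_closure:
  assumes "T \<subseteq> ell2 \<times> ell2"
  shows "adjoint_graph (graph_closure T) = adjoint_graph T"
proof
  have "T \<subseteq> graph_closure T"
  proof clarify
    fix f h assume "(f, h) \<in> T"
    moreover have "(\<lambda>_::nat. ell2_norm (\<lambda>x. f x - f x)) \<longlonglongrightarrow> 0" for f
      by (simp add: ell2_norm_def)
    ultimately show "(f, h) \<in> graph_closure T"
      using assms unfolding graph_closure_def mem_Collect_eq prod.case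
      by (intro conjI exI[where x = "\<lambda>_. f"] exI[where x = "\<lambda>_. h"]) auto
  qed
  then show "adjoint_graph (graph_closure T) \<subseteq> adjoint_graph T"
    by (auto simp: adjoint_graph_def)
next
  show "adjoint_graph T \<subseteq> adjoint_graph (graph_closure T)"
  proof clarify
    fix g k assume gk: "(g, k) \<in> adjoint_graph T"
    have "ell2_inner h g = ell2_inner f k" if fh: "(f, h) \<in> graph_closure T" for f h
    proof -
      from fh obtain F H where FH: "\<And>k::nat. (F k, H k) \<in> T"
        and F: "(\<lambda>k. ell2_norm (\<lambda>x. F k x - f x)) \<longlonglongrightarrow> 0"
        and H: "(\<lambda>k. ell2_norm (\<lambda>x. H k x - h x)) \<longlonglongrightarrow> 0"
        by (auto simp: graph_closure_def)
      have "f \<in> ell2" "h \<in> ell2" "g \<in> ell2" "k \<in> ell2" "F i \<in> ell2" "H i \<in> ell2" for i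
        using fh gk FH[of i] assms by (auto simp: graph_closure_def adjoint_graph_def)
      then have "(\<lambda>i. ell2_inner (H i) g) \<longlonglongrightarrow> ell2_inner h g"
        and "(\<lambda>i. ell2_inner (F i) k) \<longlonglongrightarrow> ell2_inner f k"
        using F H by (auto intro: tendsto_ell2_inner_left)
      moreover have "ell2_inner (H i) g = ell2_inner (F i) k" for i
        using gk FH[of i] by (auto simp: adjoint_graph_def)
      ultimately show ?thesis
        using LIMSEQ_unique by force
    qed
    then show "(g, k) \<in> adjoint_graph (graph_closure T)"
      using gk by (auto simp: adjoint_graph_def)
  qed
qed

section \<open>Row-finite hermitian matrices\<close>

text \<open>For \<open>f\<close> outside \<open>c0\<close> a row that is not summable would silently
  give 0; finiteness of the rows, assumed in the locale below, excludes this.\<close>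

definition matrix_apply :: "(int \<Rightarrow> int \<Rightarrow> complex) \<Rightarrow> (int \<Rightarrow> complex) \<Rightarrow> int \<Rightarrow> complex" where
  "matrix_apply a f x = (\<Sum>\<^sub>\<infinity>y. a x y * f y)"

text \<open>The maximal realization of the matrix in \<open>ell2\<close>; for row-finite hermitian
  matrices it is the adjoint of \<open>matrix_operator a\<close>.\<close>

definition maximal_graph :: "(int \<Rightarrow> int \<Rightarrow> complex) \<Rightarrow> graph" where
  "maximal_graph a = {(f, matrix_apply a f) | f. f \<in> ell2 \<and> matrix_apply a f \<in> ell2}"

lemma matrix_operator_alt: "matrix_operator a = {(f, matrix_apply a f) | f. f \<in> c0}"
  by (simp add: matrix_operator_def matrix_apply_def[abs_def])

lemma matrix_apply_eq_sum:
  assumes "finite S" and "\<And>y. y \<notin> S \<Longrightarrow> a x y = 0 \<or> f y = 0"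
  shows "matrix_apply a f x = (\<Sum>y\<in>S. a x y * f y)"
proof -
  have "matrix_apply a f x = (\<Sum>\<^sub>\<infinity>y\<in>S. a x y * f y)"
    unfolding matrix_apply_def by (rule infsum_cong_neutral) (use assms(2) in auto)
  then show ?thesis
    using assms(1) by simp
qed

text \<open>With finite rows every coordinate of \<open>matrix_apply a f\<close> is a finite sum for
  arbitrary \<open>f\<close>, so linearity and passage to limits need no summability
  argument.\<close>

locale row_finite_hermitian =
  fixes a :: "int \<Rightarrow> int \<Rightarrow> complex"
  assumes herm: "hermitian a"
    and row_finite: "\<And>x. finite {y. a x y \<noteq> 0}"
begin

lemma cnj_entry: "cnj (a x y) = a y x"
  using herm by (simp add: hermitian_def)

lemma entry_sym: "a y x = cnj (a x y)"
  by (simp add: cnj_entry)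

lemma matrix_apply_row: "matrix_apply a f x = (\<Sum>y | a x y \<noteq> 0. a x y * f y)"
  by (rule matrix_apply_eq_sum) (auto simp: row_finite)

lemma matrix_apply_add:
  "matrix_apply a (\<lambda>x. f x + g x) = (\<lambda>x. matrix_apply a f x + matrix_apply a g x)"
  by (rule ext) (simp add: matrix_apply_row sum.distrib algebra_simps)

lemma matrix_apply_scale: "matrix_apply a (\<lambda>x. c * f x) = (\<lambda>x. c * matrix_apply a f x)"
  by (rule ext) (simp add: matrix_apply_row sum_distrib_left algebra_simps)

lemma matrix_apply_zero: "matrix_apply a (\<lambda>_. 0) = (\<lambda>_. 0)"
  by (rule ext) (simp add: matrix_apply_row)

text \<open>By hermiticity the columns are finite as well, and the support of the image lies in the
  union of the finitely many columns that \<open>f\<close> meets.\<close>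

lemma matrix_apply_c0:
  assumes "f \<in> c0"
  shows "matrix_apply a f \<in> c0"
proof -
  have "{x. matrix_apply a f x \<noteq> 0} \<subseteq> (\<Union>y\<in>{y. f y \<noteq> 0}. {x. a y x \<noteq> 0})"
  proof
    fix x assume "x \<in> {x. matrix_apply a f x \<noteq> 0}"
    then obtain y where "a x y * f y \<noteq> 0"
      unfolding matrix_apply_row mem_Collect_eq by (meson sum.neutral)
    then show "x \<in> (\<Union>y\<in>{y. f y \<noteq> 0}. {x. a y x \<noteq> 0})"
      by (auto simp: entry_sym[of _ x])
  qed
  moreover have "finite (\<Union>y\<in>{y. f y \<noteq> 0}. {x. a y x \<noteq> 0})"
    using assms row_finite by (simp add: c0_def)
  ultimately show ?thesis
    unfolding c0_def using finite_subset by auto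
qed

text \<open>Finite support of \<open>f\<close> collapses both sides to one finite double sum, so
  \<open>g\<close> may be any sequence. This yields both the symmetry of the operator and half of
  the description of its adjoint.\<close>

lemma ell2_inner_matrix_apply:
  assumes "f \<in> c0"
  shows "ell2_inner (matrix_apply a f) g = ell2_inner f (matrix_apply a g)"
proof -
  define S where "S = {y. f y \<noteq> 0}"
  \<comment> \<open>\<open>T\<close> contains the support of \<open>matrix_apply a f\<close> and
    also every row support needed to evaluate \<open>matrix_apply a g\<close> on
    \<open>S\<close>.\<close>
  define T where "T = (\<Union>y\<in>S. {x. a y x \<noteq> 0})"
  have S: "finite S"
    using assms by (simp add: S_def c0_def)
  then have T: "finite T"
    by (simp add: T_def row_finite)
  have f_apply: "matrix_apply a f x = (\<Sum>y\<in>S. a x y * f y)" for x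
    by (rule matrix_apply_eq_sum) (use S in \<open>auto simp: S_def\<close>)
  have outside: "matrix_apply a f x = 0" if "x \<notin> T" for x
    unfolding f_apply using that by (intro sum.neutral) (auto simp: T_def entry_sym[of x])
  have g_apply: "matrix_apply a g y = (\<Sum>x\<in>T. a y x * g x)" if "y \<in> S" for y
    by (rule matrix_apply_eq_sum) (use T that in \<open>auto simp: T_def\<close>)
  have "ell2_inner (matrix_apply a f) g = (\<Sum>\<^sub>\<infinity>x\<in>T. cnj (matrix_apply a f x) * g x)"
    unfolding ell2_inner_def by (rule infsum_cong_neutral) (auto simp: outside)
  also have "\<dots> = (\<Sum>x\<in>T. \<Sum>y\<in>S. cnj (f y) * (a y x * g x))"
    using T by (simp add: f_apply sum_distrib_right sum_distrib_left cnj_entry mult_ac)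
  also have "\<dots> = (\<Sum>y\<in>S. cnj (f y) * matrix_apply a g y)"
    by (subst sum.swap) (simp add: g_apply sum_distrib_left)
  also have "\<dots> = (\<Sum>\<^sub>\<infinity>y\<in>S. cnj (f y) * matrix_apply a g y)"
    using S by simp
  also have "\<dots> = ell2_inner f (matrix_apply a g)"
    unfolding ell2_inner_def by (rule infsum_cong_neutral) (auto simp: S_def)
  finally show ?thesis .
qed

lemma linear_operator_matrix_operator: "linear_operator (matrix_operator a)"
proof -
  have "(\<lambda>x. f x + g x) \<in> c0" if "f \<in> c0" "g \<in> c0" for f g
    using that unfolding c0_def mem_Collect_eq
    by (auto intro: finite_subset[of _ "{x. f x \<noteq> 0} \<union> {x. g x \<noteq> 0}"])
  moreover have "(\<lambda>x. c * f x) \<in> c0" if "f \<in> c0" for c f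
    using that unfolding c0_def mem_Collect_eq by (elim finite_subset[rotated]) auto
  moreover have "(\<lambda>_. 0) \<in> c0"
    by (simp add: c0_def)
  ultimately show ?thesis
    using c0_subset_ell2 matrix_apply_c0 unfolding linear_operator_def matrix_operator_alt
    by (auto simp: single_valued_def matrix_apply_add matrix_apply_scale matrix_apply_zero)
qed

lemma linear_operator_maximal_graph: "linear_operator (maximal_graph a)"
proof -
  have "(\<lambda>_. 0) \<in> ell2"
    by (simp add: ell2_def)
  then show ?thesis
    unfolding linear_operator_def maximal_graph_def
    by (auto simp: single_valued_def matrix_apply_add matrix_apply_scale matrix_apply_zero
        intro: ell2_add ell2_scale)
qed

lemma matrix_operator_subset_maximal_graph: "matrix_operator a \<subseteq> maximal_graph a"
  using c0_subset_ell2 matrix_apply_c0 by (auto simp: matrix_operator_alt maximal_graph_def)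

text \<open>One inclusion is the symmetry identity for arbitrary \<open>g\<close>. For the other,
  testing against the unit vector at \<open>x\<close> reads off the coordinate
  \<open>k x\<close>.\<close>

lemma adjoint_graph_matrix_operator: "adjoint_graph (matrix_operator a) = maximal_graph a"
proof
  show "maximal_graph a \<subseteq> adjoint_graph (matrix_operator a)"
    by (auto simp: maximal_graph_def adjoint_graph_def matrix_operator_alt ell2_inner_matrix_apply)
  show "adjoint_graph (matrix_operator a) \<subseteq> maximal_graph a"
  proof clarify
    fix g k assume gk: "(g, k) \<in> adjoint_graph (matrix_operator a)"
    have "k x = matrix_apply a g x" for x
    proof -
      define \<delta> :: "int \<Rightarrow> complex" where "\<delta> = (\<lambda>y. if y = x then 1 else 0)"
      have inner_\<delta>: "ell2_inner \<delta> h = h x" for h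
      proof -
        have "ell2_inner \<delta> h = (\<Sum>\<^sub>\<infinity>y\<in>{x}. cnj (\<delta> y) * h y)"
          unfolding ell2_inner_def by (rule infsum_cong_neutral) (auto simp: \<delta>_def)
        then show ?thesis by (simp add: \<delta>_def)
      qed
      have "\<delta> \<in> c0"
        by (simp add: \<delta>_def c0_def)
      then have "ell2_inner (matrix_apply a \<delta>) g = ell2_inner \<delta> k"
        using gk by (auto simp: adjoint_graph_def matrix_operator_alt)
      then show ?thesis
        by (simp add: ell2_inner_matrix_apply[OF \<open>\<delta> \<in> c0\<close>] inner_\<delta>)
    qed
    then have "k = matrix_apply a g" ..
    then show "(g, k) \<in> maximal_graph a"
      using gk by (auto simp: adjoint_graph_def maximal_graph_def)
  qed
qed

text \<open>Norm convergence implies convergence of each coordinate, and a coordinate of the image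
  involves only finitely many coordinates of the argument.\<close>

lemma graph_closure_subset_maximal_graph: "graph_closure (matrix_operator a) \<subseteq> maximal_graph a"
proof clarify
  fix f h assume fh: "(f, h) \<in> graph_closure (matrix_operator a)"
  then obtain F H where FH: "\<And>k::nat. (F k, H k) \<in> matrix_operator a"
    and F: "(\<lambda>k. ell2_norm (\<lambda>x. F k x - f x)) \<longlonglongrightarrow> 0"
    and H: "(\<lambda>k. ell2_norm (\<lambda>x. H k x - h x)) \<longlonglongrightarrow> 0"
    and "f \<in> ell2" "h \<in> ell2"
    by (auto simp: graph_closure_def)
  have H_eq: "H k = matrix_apply a (F k)" and "F k \<in> ell2" "H k \<in> ell2" for k
    using FH[of k] matrix_operator_subset_maximal_graph by (auto simp: maximal_graph_def)
  have F_lim: "(\<lambda>k. F k y) \<longlonglongrightarrow> f y" for y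
    by (rule tendsto_ell2_pointwise) fact+
  have "h x = matrix_apply a f x" for x
  proof (rule LIMSEQ_unique)
    show "(\<lambda>k. H k x) \<longlonglongrightarrow> h x"
      by (rule tendsto_ell2_pointwise) fact+
    show "(\<lambda>k. H k x) \<longlonglongrightarrow> matrix_apply a f x"
      unfolding H_eq matrix_apply_row
      by (intro tendsto_intros F_lim)
  qed
  then have "h = matrix_apply a f" ..
  then show "(f, h) \<in> maximal_graph a"
    using \<open>f \<in> ell2\<close> \<open>h \<in> ell2\<close> by (simp add: maximal_graph_def)
qed

text \<open>Under the assumption the closure equals the maximal graph, which is single-valued and is
  the adjoint of the matrix operator. Since an operator and its closure have the same adjoint, the
  closure is its own adjoint.\<close>

lemma essentially_self_adjointI:
  assumes "maximal_graph a \<subseteq> graph_closure (matrix_operator a)"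
  shows "essentially_self_adjoint (matrix_operator a)"
proof -
  have closure_eq: "graph_closure (matrix_operator a) = maximal_graph a"
    using assms graph_closure_subset_maximal_graph by blast
  have sub: "maximal_graph a \<subseteq> ell2 \<times> ell2" "matrix_operator a \<subseteq> ell2 \<times> ell2"
    using matrix_operator_subset_maximal_graph by (auto simp: maximal_graph_def)
  have "c0 \<subseteq> Domain (matrix_operator a)"
    by (auto simp: matrix_operator_alt)
  then have dense: "ell2_dense (Domain (matrix_operator a))" "ell2_dense (Domain (maximal_graph a))"
    using sub matrix_operator_subset_maximal_graph
    by (intro ell2_dense_c0; blast dest: Domain_mono)+
  have "symmetric_operator (matrix_operator a)"
    unfolding symmetric_operator_def using linear_operator_matrix_operator dense
    by (auto simp: matrix_operator_alt ell2_inner_matrix_apply)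
  moreover have "closable (matrix_operator a)"
    using linear_operator_matrix_operator linear_operator_maximal_graph
    by (simp add: closable_def closure_eq linear_operator_def)
  moreover have "adjoint_graph (maximal_graph a) = maximal_graph a"
    using adjoint_graph_closure[OF sub(2)] by (simp add: closure_eq adjoint_graph_matrix_operator)
  ultimately show ?thesis
    using linear_operator_maximal_graph dense
    by (simp add: essentially_self_adjoint_def self_adjoint_def closure_eq)
qed

end

section \<open>Banded hermitian matrices and cutoffs\<close>

lemma jbracket_ge_1: "1 \<le> jbracket z"
  by (simp add: jbracket_def)

lemma jbracket_le: "jbracket z \<le> 1 + cmod z"
  unfolding jbracket_def by (rule real_le_lsqrt) (auto simp: power2_eq_square algebra_simps)

text \<open>The bracket of \<open>z\<close> is the Euclidean length of the plane vector with entries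
  1 and \<open>cmod z\<close>; the claim is the triangle inequality after adding the vector with
  entries 0 and \<open>cmod (w - z)\<close>.\<close>

lemma jbracket_triangle: "jbracket w \<le> jbracket z + cmod (w - z)"
proof -
  have "jbracket w \<le> sqrt ((1 + 0)\<^sup>2 + (cmod z + cmod (w - z))\<^sup>2)"
    unfolding jbracket_def using norm_triangle_ineq[of z "w - z"]
    by (intro real_sqrt_le_mono add_mono power_mono) auto
  also have "\<dots> \<le> sqrt (1\<^sup>2 + (cmod z)\<^sup>2) + sqrt (0\<^sup>2 + (cmod (w - z))\<^sup>2)"
    by (rule real_sqrt_sum_squares_triangle_ineq)
  finally show ?thesis
    by (simp add: jbracket_def)
qed

lemma jbracket_triangle_int: "jbracket (of_int y) \<le> jbracket (of_int x) + \<bar>real_of_int (x - y)\<bar>"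
proof -
  have "cmod (of_int y - of_int x) = \<bar>real_of_int (x - y)\<bar>"
    by (metis abs_minus_commute norm_of_int of_int_abs of_int_diff)
  then show ?thesis
    using jbracket_triangle[of "of_int y" "of_int x"] by simp
qed

text \<open>A tent is used instead of a sharp truncation because its Lipschitz constant
  \<open>1 / R\<close> is the source of smallness in the commutator.\<close>

definition cutoff :: "real \<Rightarrow> int \<Rightarrow> real" where
  "cutoff R x = max 0 (1 - \<bar>real_of_int x\<bar> / R)"

lemma cutoff_bounds: "R > 0 \<Longrightarrow> 0 \<le> cutoff R x" "R > 0 \<Longrightarrow> cutoff R x \<le> 1"
  by (auto simp: cutoff_def)

lemma cutoff_eq_0: "R > 0 \<Longrightarrow> R \<le> \<bar>real_of_int x\<bar> \<Longrightarrow> cutoff R x = 0"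
  by (simp add: cutoff_def)

lemma cutoff_lipschitz:
  assumes "R > 0"
  shows "\<bar>cutoff R y - cutoff R x\<bar> \<le> \<bar>real_of_int (x - y)\<bar> / R"
proof -
  have "\<bar>cutoff R y - cutoff R x\<bar> \<le> \<bar>\<bar>real_of_int x\<bar> / R - \<bar>real_of_int y\<bar> / R\<bar>"
    unfolding cutoff_def by linarith
  also have "\<dots> = \<bar>\<bar>real_of_int x\<bar> - \<bar>real_of_int y\<bar>\<bar> / R"
    using assms by (simp flip: diff_divide_distrib)
  also have "\<dots> \<le> \<bar>real_of_int (x - y)\<bar> / R"
    using assms by (intro divide_right_mono) auto
  finally show ?thesis .
qed

lemma cutoff_mult_c0:
  assumes "R > 0"
  shows "(\<lambda>x. of_real (cutoff R x) * g x) \<in> c0"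
proof -
  have "{x. of_real (cutoff R x) * g x \<noteq> 0} \<subseteq> {- \<lceil>R\<rceil>..\<lceil>R\<rceil>}"
  proof
    fix x assume "x \<in> {x. of_real (cutoff R x) * g x \<noteq> 0}"
    then have "\<bar>real_of_int x\<bar> < R"
      using cutoff_eq_0[OF assms, of x] by fastforce
    then show "x \<in> {- \<lceil>R\<rceil>..\<lceil>R\<rceil>}"
      by simp linarith
  qed
  then show ?thesis
    unfolding c0_def by (simp add: finite_subset)
qed

lemma tendsto_cutoff: "(\<lambda>k. of_real (cutoff (real (Suc k)) x) :: complex) \<longlonglongrightarrow> 1"
proof -
  have "(\<lambda>k. 1 - \<bar>real_of_int x\<bar> / real (Suc k)) \<longlonglongrightarrow> 1 - 0"
    using LIMSEQ_Suc[OF lim_const_over_n] by (intro tendsto_intros) blast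
  then have "(\<lambda>k. max 0 (1 - \<bar>real_of_int x\<bar> / real (Suc k))) \<longlonglongrightarrow> max 0 (1 - 0)"
    by (intro tendsto_max tendsto_const)
  then have "(\<lambda>k. of_real (cutoff (real (Suc k)) x) :: complex) \<longlonglongrightarrow> of_real 1"
    unfolding cutoff_def by (intro tendsto_of_real) simp
  then show ?thesis by simp
qed

text \<open>The hypotheses in working form: the band is two-sided, with a real constant
  \<open>K\<close>, and the growth condition is free of quotients and filters.\<close>

locale banded_hermitian =
  fixes a :: "int \<Rightarrow> int \<Rightarrow> complex" and K \<gamma> :: real
  assumes hermitian: "hermitian a"
    and band: "\<And>x y. a x y \<noteq> 0 \<Longrightarrow> \<bar>real_of_int (x - y)\<bar> \<le> K * jbracket (of_int x) powr \<gamma>"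
    and K_ge_1: "1 \<le> K" and \<gamma>_nonneg: "0 \<le> \<gamma>" and \<gamma>_less_1: "\<gamma> < 1"
    and row_sum_limit: "\<And>\<delta>. \<delta> > 0 \<Longrightarrow> \<exists>N. \<forall>x. \<bar>x\<bar> \<ge> N \<longrightarrow>
      (\<Sum>\<^sub>\<infinity>y. cmod (a x y)) \<le> \<delta> * jbracket (of_int x) powr (1 - \<gamma>)"

sublocale banded_hermitian \<subseteq> row_finite_hermitian
proof
  show "finite {y. a x y \<noteq> 0}" for x
  proof (rule finite_subset)
    let ?t = "\<lceil>K * jbracket (of_int x) powr \<gamma>\<rceil>"
    show "{y. a x y \<noteq> 0} \<subseteq> {x - ?t..x + ?t}"
    proof
      fix y assume "y \<in> {y. a x y \<noteq> 0}"
      then have "\<bar>real_of_int (x - y)\<bar> \<le> K * jbracket (of_int x) powr \<gamma>"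
        using band by simp
      then have "\<bar>x - y\<bar> \<le> ?t"
        by linarith
      then show "y \<in> {x - ?t..x + ?t}"
        by auto
    qed
  qed simp
qed (fact hermitian)

section \<open>Estimates for the commutator with the cutoff\<close>

context banded_hermitian
begin

text \<open>The matrix of \<open>A u - u A\<close>, where \<open>u\<close> is multiplication by the
  cutoff.\<close>

definition cutoff_commutator :: "real \<Rightarrow> int \<Rightarrow> int \<Rightarrow> complex" where
  "cutoff_commutator R x y = a x y * of_real (cutoff R y - cutoff R x)"

text \<open>Turns row bounds into column bounds, so the Schur test needs only the former.\<close>

lemma cmod_cutoff_commutator_sym:
  "cmod (cutoff_commutator R x y) = cmod (cutoff_commutator R y x)"
  by (simp add: cutoff_commutator_def norm_mult entry_sym[of x y] abs_minus_commute
      flip: of_real_diff)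

text \<open>On a nonzero entry the band limits the distance of \<open>x\<close> and
  \<open>y\<close>, and the Lipschitz bound converts this distance into a small difference of cutoff
  values.\<close>

lemma cutoff_commutator_row_sum_le:
  assumes "R > 0" and "finite S"
  shows "(\<Sum>y\<in>S. cmod (cutoff_commutator R x y))
    \<le> K * jbracket (of_int x) powr \<gamma> * (\<Sum>\<^sub>\<infinity>y. cmod (a x y)) / R"
proof -
  have "(\<Sum>y\<in>S. cmod (cutoff_commutator R x y))
      \<le> (\<Sum>y\<in>S. cmod (a x y) * (K * jbracket (of_int x) powr \<gamma> / R))"
  proof (rule sum_mono)
    fix y
    have "\<bar>cutoff R y - cutoff R x\<bar> \<le> K * jbracket (of_int x) powr \<gamma> / R" if "a x y \<noteq> 0"
      using band[OF that] cutoff_lipschitz[OF assms(1), of y x] assms(1)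
      by (meson divide_right_mono less_imp_le order_trans)
    then show "cmod (cutoff_commutator R x y) \<le> cmod (a x y) * (K * jbracket (of_int x) powr \<gamma> / R)"
      unfolding cutoff_commutator_def norm_mult norm_of_real
      by (cases "a x y = 0") (simp, intro mult_left_mono, auto)
  qed
  also have "\<dots> = (K * jbracket (of_int x) powr \<gamma> / R) * (\<Sum>y\<in>S. cmod (a x y))"
    unfolding sum_distrib_right[symmetric] by (rule mult.commute)
  also have "\<dots> \<le> (K * jbracket (of_int x) powr \<gamma> / R) * (\<Sum>\<^sub>\<infinity>y. cmod (a x y))"
    using assms row_finite[of x] K_ge_1
    by (intro mult_left_mono finite_sum_le_infsum finite_nonzero_values_imp_summable_on) auto
  finally show ?thesis
    by simp
qed

text \<open>If \<open>x\<close> is far outside the tent, then so is every \<open>y\<close> coupled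
  to it, and both cutoff values vanish.\<close>

lemma cutoff_commutator_eq_0:
  assumes "R \<ge> 1" and "jbracket (of_int x) > 2 * (1 + K) * R"
  shows "cutoff_commutator R x y = 0"
proof (cases "a x y = 0")
  case False
  have "jbracket (of_int y) powr \<gamma> \<le> jbracket (of_int y)"
    using powr_mono[of \<gamma> 1 "jbracket (of_int y)"] jbracket_ge_1[of "of_int y"] \<gamma>_less_1 by simp
  \<comment> \<open>The band is used from the side of \<open>y\<close>, since a lower bound for
    \<open>jbracket (of_int y)\<close> in terms of \<open>jbracket (of_int x)\<close> is
    wanted.\<close>
  moreover have "\<bar>real_of_int (y - x)\<bar> \<le> K * jbracket (of_int y) powr \<gamma>"
    using False by (intro band) (simp add: entry_sym[of y])
  ultimately have "\<bar>real_of_int (y - x)\<bar> \<le> K * jbracket (of_int y)"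
    using K_ge_1 by (meson dual_order.trans mult_left_mono zero_le_one)
  then have "jbracket (of_int x) \<le> (1 + K) * jbracket (of_int y)"
    using jbracket_triangle_int[of x y] by (simp add: algebra_simps)
  then have "(1 + K) * (2 * R) < (1 + K) * jbracket (of_int y)"
    using assms(2) by (simp add: algebra_simps)
  then have "2 * R < jbracket (of_int y)"
    using K_ge_1 by simp
  \<comment> \<open>The factor 2 in the threshold pays for the 1 in \<open>jbracket_le\<close>:
    \<open>2 * R - 1\<close> is at least \<open>R\<close> because \<open>R \<ge> 1\<close>.\<close>
  then have "R \<le> \<bar>real_of_int y\<bar>"
    using jbracket_le[of "of_int y"] assms(1) by simp
  moreover have "2 * 1 * R \<le> 2 * (1 + K) * R"
    using assms(1) K_ge_1 by (intro mult_right_mono) auto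
  then have "R \<le> \<bar>real_of_int x\<bar>"
    using jbracket_le[of "of_int x"] assms unfolding norm_of_int by linarith
  ultimately show ?thesis
    using assms(1) by (simp add: cutoff_commutator_def cutoff_eq_0)
qed (simp add: cutoff_commutator_def)

text \<open>Away from the origin the row sums are controlled by the growth hypothesis and the fact that
  only rows with \<open>jbracket x \<le> 2 * (1 + K) * R\<close> meet the commutator; the finitely many remaining rows are
  damped by the factor \<open>1/R\<close>.\<close>

lemma cutoff_commutator_row_sum_small:
  assumes "\<epsilon> > 0"
  shows "\<forall>\<^sub>F R in at_top. \<forall>x S. finite S \<longrightarrow> (\<Sum>y\<in>S. cmod (cutoff_commutator R x y)) \<le> \<epsilon>"
proof -
  define s where "s x = (\<Sum>\<^sub>\<infinity>y. cmod (a x y))" for x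
  define L where "L = 2 * (1 + K)"
  have s_nonneg: "s x \<ge> 0" for x
    by (simp add: s_def infsum_nonneg)
  have "L > 0" "K > 0"
    using K_ge_1 by (auto simp: L_def)
  \<comment> \<open>The tolerance is divided by \<open>K\<close> to cancel the band constant and by
    \<open>L\<close> to cancel the bound \<open>L * R\<close> on the bracket in the third
    case.\<close>
  then obtain N where N: "\<And>x. \<bar>x\<bar> \<ge> N \<Longrightarrow> s x \<le> \<epsilon> / (K * L) * jbracket (of_int x) powr (1 - \<gamma>)"
    using row_sum_limit[of "\<epsilon> / (K * L)"] \<open>\<epsilon> > 0\<close> unfolding s_def by auto
  \<comment> \<open>A sum of nonnegative terms dominates each of them, so one condition on
    \<open>R\<close> handles all rows near the origin.\<close>
  define B where "B = (\<Sum>x\<in>{- N..N}. K * jbracket (of_int x) powr \<gamma> * s x)"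
  have "(\<Sum>y\<in>S. cmod (cutoff_commutator R x y)) \<le> \<epsilon>"
    if R: "R \<ge> 1" "R \<ge> B / \<epsilon>" and "finite S" for R x S
  proof -
    let ?J = "jbracket (of_int x)"
    have "R > 0" using R by simp
    have bound: "(\<Sum>y\<in>S. cmod (cutoff_commutator R x y)) \<le> K * ?J powr \<gamma> * s x / R"
      unfolding s_def by (rule cutoff_commutator_row_sum_le) fact+
    consider "?J > L * R" | "\<bar>x\<bar> < N" | "\<bar>x\<bar> \<ge> N" "?J \<le> L * R"
      by linarith
    then show ?thesis
    proof cases
      case 1
      then show ?thesis
        using cutoff_commutator_eq_0[OF R(1), of x] \<open>\<epsilon> > 0\<close> by (simp add: L_def)
    next
      case 2
      then have "K * ?J powr \<gamma> * s x \<le> B"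
        unfolding B_def using \<open>K > 0\<close> s_nonneg
        by (intro member_le_sum[of x "{- N..N}" "\<lambda>x. K * jbracket (of_int x) powr \<gamma> * s x"]) auto
      also have "B \<le> \<epsilon> * R"
        using R(2) \<open>\<epsilon> > 0\<close> by (simp add: field_simps)
      finally have "K * ?J powr \<gamma> * s x / R \<le> \<epsilon>"
        using \<open>R > 0\<close> by (simp add: field_simps)
      then show ?thesis
        using bound by linarith
    next
      case 3
      have "K * ?J powr \<gamma> * s x \<le> K * ?J powr \<gamma> * (\<epsilon> / (K * L) * ?J powr (1 - \<gamma>))"
        using \<open>K > 0\<close> N[OF 3(1)] by (intro mult_left_mono) auto
      also have "\<dots> = \<epsilon> / L * (?J powr \<gamma> * ?J powr (1 - \<gamma>))"
        using \<open>K > 0\<close> by simp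
      \<comment> \<open>Here the band exponent and the growth exponent balance: their product is
        linear in the bracket, hence of order \<open>R\<close>.\<close>
      also have "?J powr \<gamma> * ?J powr (1 - \<gamma>) = ?J"
        using jbracket_ge_1[of "of_int x"] by (simp flip: powr_add)
      also have "\<epsilon> / L * ?J \<le> \<epsilon> / L * (L * R)"
        using 3(2) \<open>\<epsilon> > 0\<close> \<open>L > 0\<close> by (intro mult_left_mono) auto
      also have "\<dots> = \<epsilon> * R"
        using \<open>L > 0\<close> by simp
      finally have "K * ?J powr \<gamma> * s x / R \<le> \<epsilon>"
        using \<open>R > 0\<close> by (simp add: field_simps)
      then show ?thesis
        using bound by linarith
    qed
  qed
  then show ?thesis
    using eventually_ge_at_top[of "max 1 (B / \<epsilon>)"] by (auto elim!: eventually_mono)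
qed

text \<open>Coordinatewise \<open>h\<close> is the commutator applied to \<open>g\<close>. A finite
  set \<open>F\<close> of rows meets only finitely many columns, so the finite Schur test applies on
  each \<open>F\<close>.\<close>

lemma cutoff_commutator_bound:
  assumes "g \<in> ell2" and "\<epsilon> \<ge> 0"
    and row: "\<And>x S. finite S \<Longrightarrow> (\<Sum>y\<in>S. cmod (cutoff_commutator R x y)) \<le> \<epsilon>"
  defines "h \<equiv> (\<lambda>x. matrix_apply a (\<lambda>y. of_real (cutoff R y) * g y) x
    - of_real (cutoff R x) * matrix_apply a g x)"
  shows "ell2_norm h \<le> \<epsilon> * ell2_norm g"
proof -
  have "L2_set (\<lambda>x. cmod (h x)) F \<le> \<epsilon> * ell2_norm g" if "finite F" for F
  proof -
    define G where "G = (\<Union>x\<in>F. {y. a x y \<noteq> 0})"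
    have "finite G"
      using that row_finite by (simp add: G_def)
    have apply_eq: "matrix_apply a f x = (\<Sum>y\<in>G. a x y * f y)" if "x \<in> F" for f x
      using \<open>finite G\<close> that by (intro matrix_apply_eq_sum) (auto simp: G_def)
    have "h x = (\<Sum>y\<in>G. cutoff_commutator R x y * g y)" if "x \<in> F" for x
      unfolding h_def apply_eq[OF that] cutoff_commutator_def
      by (simp add: sum_distrib_left algebra_simps flip: sum_subtractf)
    then have "L2_set (\<lambda>x. cmod (h x)) F = L2_set (\<lambda>x. cmod (\<Sum>y\<in>G. cutoff_commutator R x y * g y)) F"
      by (intro L2_set_cong) auto
    also have "\<dots> \<le> \<epsilon> * L2_set (\<lambda>y. cmod (g y)) G"
      using row[OF \<open>finite G\<close>] row[OF \<open>finite F\<close>] \<open>\<epsilon> \<ge> 0\<close>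
      by (intro schur_test_finite) (auto simp: cmod_cutoff_commutator_sym[of R _ y for y])
    also have "\<dots> \<le> \<epsilon> * ell2_norm g"
      using \<open>\<epsilon> \<ge> 0\<close> \<open>finite G\<close> assms(1) by (intro mult_left_mono L2_set_le_ell2_norm)
    finally show ?thesis .
  qed
  then show ?thesis
    by (fact ell2I)
qed

text \<open>The error \<open>A (u g) - A g\<close> splits into the commutator applied to
  \<open>g\<close> and \<open>u (A g) - A g\<close>. The latter tends to 0 because
  \<open>A g\<close> itself lies in \<open>ell2\<close>.\<close>

lemma maximal_graph_subset_graph_closure: "maximal_graph a \<subseteq> graph_closure (matrix_operator a)"
proof clarify
  fix g h assume "(g, h) \<in> maximal_graph a"
  then have g: "g \<in> ell2" and h: "h \<in> ell2" and h_eq: "h = matrix_apply a g"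
    by (auto simp: maximal_graph_def)
  \<comment> \<open>The radius is \<open>Suc k\<close> so that it is positive from
    \<open>k = 0\<close> on.\<close>
  define u :: "nat \<Rightarrow> int \<Rightarrow> complex" where "u k x = of_real (cutoff (real (Suc k)) x)" for k x
  define F where "F k = (\<lambda>x. u k x * g x)" for k
  define H where "H k = matrix_apply a (F k)" for k
  define E where "E k = (\<lambda>x. H k x - u k x * h x)" for k
  have u_le: "cmod (u k x) \<le> 1" for k x
    unfolding u_def norm_of_real using cutoff_bounds[of "real (Suc k)" x] by simp
  have u_lim: "(\<lambda>k. u k x) \<longlonglongrightarrow> 1" for x
    unfolding u_def by (rule tendsto_cutoff)
  have "F k \<in> c0" for k
    unfolding F_def u_def by (rule cutoff_mult_c0) simp
  then have FH: "(F k, H k) \<in> matrix_operator a" for k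
    by (auto simp: matrix_operator_alt H_def)
  have H_ell2: "H k \<in> ell2" for k
    using FH[of k] matrix_operator_subset_maximal_graph by (auto simp: maximal_graph_def)
  have uh_ell2: "(\<lambda>x. u k x * h x) \<in> ell2" for k
    by (rule ell2_bounded_mult[OF h u_le])
  have uh_lim: "(\<lambda>k. ell2_norm (\<lambda>x. u k x * h x - h x)) \<longlonglongrightarrow> 0"
    by (rule ell2_norm_multiplier_tendsto_0[OF h u_le u_lim])
  have E_lim: "(\<lambda>k. ell2_norm (E k)) \<longlonglongrightarrow> 0"
  proof (rule LIMSEQ_I)
    fix \<epsilon> :: real assume "\<epsilon> > 0"
    \<comment> \<open>Adding 1 to the norm covers the case of norm 0 and makes the final inequality
      strict.\<close>
    define \<delta> where "\<delta> = \<epsilon> / (ell2_norm g + 1)"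
    have "\<delta> > 0"
      using \<open>\<epsilon> > 0\<close> by (simp add: \<delta>_def add_nonneg_pos)
    have lim: "filterlim (\<lambda>k. real (Suc k)) at_top sequentially"
      by (rule filterlim_compose[OF filterlim_real_sequentially filterlim_Suc])
    have "\<delta> * ell2_norm g < \<delta> * (ell2_norm g + 1)"
      using \<open>\<delta> > 0\<close> by simp
    also have "\<dots> = \<epsilon>"
      using ell2_norm_nonneg[of g] by (simp add: \<delta>_def add_nonneg_eq_0_iff)
    finally have "\<delta> * ell2_norm g < \<epsilon>" .
    moreover have "ell2_norm (E k) \<le> \<delta> * ell2_norm g"
      if "\<forall>x S. finite S \<longrightarrow> (\<Sum>y\<in>S. cmod (cutoff_commutator (real (Suc k)) x y)) \<le> \<delta>" for k
      unfolding E_def H_def F_def u_def h_eq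
      by (rule cutoff_commutator_bound[OF g]) (use that \<open>\<delta> > 0\<close> in auto)
    ultimately have "\<forall>\<^sub>F k in sequentially. ell2_norm (E k) < \<epsilon>"
      using eventually_compose_filterlim[OF cutoff_commutator_row_sum_small[OF \<open>\<delta> > 0\<close>] lim]
      by (auto elim!: eventually_mono intro: le_less_trans)
    then show "\<exists>m. \<forall>k\<ge>m. norm (ell2_norm (E k) - 0) < \<epsilon>"
      by (simp add: eventually_sequentially)
  qed
  have "ell2_norm (\<lambda>x. H k x - h x) \<le> ell2_norm (E k) + ell2_norm (\<lambda>x. u k x * h x - h x)" for k
    using ell2_add(2)[OF ell2_diff[OF H_ell2[of k] uh_ell2[of k]] ell2_diff[OF uh_ell2[of k] h]]
    by (simp add: E_def)
  then have "(\<lambda>k. ell2_norm (\<lambda>x. H k x - h x)) \<longlonglongrightarrow> 0"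
    by (intro tendsto_sandwich[OF _ _ tendsto_const tendsto_add_zero[OF E_lim uh_lim]])
      (auto intro!: always_eventually)
  moreover have "(\<lambda>k. ell2_norm (\<lambda>x. F k x - g x)) \<longlonglongrightarrow> 0"
    unfolding F_def by (rule ell2_norm_multiplier_tendsto_0[OF g u_le u_lim])
  ultimately show "(g, h) \<in> graph_closure (matrix_operator a)"
    unfolding graph_closure_def using g h FH by blast
qed

end

section \<open>Passage from the one-sided to the two-sided band\<close>

text \<open>For \<open>y < x\<close> hermiticity gives a bound through the bracket of
  \<open>y\<close>, which must be traded for that of \<open>x\<close>. If the distance
  \<open>t\<close> is at most the bracket of \<open>x\<close>, the two brackets are comparable.
  Otherwise \<open>t\<close> is bounded by a multiple of its own power \<open>\<gamma> < 1\<close>,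
  hence by a constant.\<close>

lemma symmetric_band_bound:
  fixes a :: "int \<Rightarrow> int \<Rightarrow> complex" and n \<gamma> :: real
  assumes "hermitian a" and "n \<ge> 1" and "0 \<le> \<gamma>" and "\<gamma> < 1"
    and upper: "\<And>x z. real_of_int z > n * jbracket (of_int x) powr \<gamma> \<Longrightarrow> a x (x + z) = 0"
    and "a x y \<noteq> 0"
  shows "\<bar>real_of_int (x - y)\<bar> \<le> (2 * n) powr (1 / (1 - \<gamma>)) * jbracket (of_int x) powr \<gamma>"
proof -
  define K where "K = (2 * n) powr (1 / (1 - \<gamma>))"
  define t where "t = \<bar>real_of_int (x - y)\<bar>"
  let ?J = "\<lambda>x::int. jbracket (of_int x)"
  have J: "1 \<le> ?J x" "1 \<le> ?J y" "1 \<le> ?J x powr \<gamma>"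
    using jbracket_ge_1 assms by (auto intro: ge_one_powr_ge_zero)
  have "(2 * n) powr 1 \<le> K"
    unfolding K_def using assms by (intro powr_mono) auto
  then have K: "2 * n \<le> K"
    using assms by simp
  have K_step: "2 * n * ?J x powr \<gamma> \<le> K * ?J x powr \<gamma>"
    using K by (intro mult_right_mono) auto
  have two_powr: "2 powr \<gamma> \<le> 2"
    using powr_mono[of \<gamma> 1 2] assms by simp
  have "t \<le> K * ?J x powr \<gamma>"
  proof (cases "x \<le> y")
    case True
    have "t \<le> n * ?J x powr \<gamma>"
      using upper[of x "y - x"] \<open>a x y \<noteq> 0\<close> True by (force simp: t_def)
    also have "\<dots> \<le> 2 * n * ?J x powr \<gamma>"
      using assms by (intro mult_right_mono) auto
    finally show ?thesis
      using K_step by linarith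
  next
    case False
    have "a y x \<noteq> 0"
      using \<open>a x y \<noteq> 0\<close> \<open>hermitian a\<close> by (metis complex_cnj_zero hermitian_def)
    then have t_le: "t \<le> n * ?J y powr \<gamma>"
      using upper[of y "x - y"] False by (force simp: t_def)
    have J_y: "?J y \<le> ?J x + t"
      unfolding t_def by (rule jbracket_triangle_int)
    \<comment> \<open>Used with \<open>s\<close> equal to the bracket of \<open>x\<close> and with
      \<open>s = t\<close>, one for each of the two regimes.\<close>
    have double: "t \<le> 2 * n * s powr \<gamma>" if "?J y \<le> 2 * s" "s \<ge> 1" for s
    proof -
      have "?J y powr \<gamma> \<le> (2 * s) powr \<gamma>"
        using that J assms by (intro powr_mono2) auto
      also have "\<dots> \<le> 2 * s powr \<gamma>"
        using that two_powr by (simp add: powr_mult mult_right_mono)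
      finally have "n * ?J y powr \<gamma> \<le> n * (2 * s powr \<gamma>)"
        using assms by (intro mult_left_mono) auto
      then show ?thesis
        using t_le by (simp add: mult_ac)
    qed
    show ?thesis
    proof (cases "t \<le> ?J x")
      case True
      then show ?thesis
        using double[of "?J x"] J J_y K_step by linarith
    next
      case far: False
      then have "t \<ge> 1"
        using J by linarith
      \<comment> \<open>Cancelling \<open>t powr \<gamma>\<close> leaves a bound on
        \<open>t powr (1 - \<gamma>)\<close>; taking the root is where the exponent
        \<open>1 / (1 - \<gamma>)\<close> in \<open>K\<close> comes from.\<close>
      have "t powr (1 - \<gamma>) * t powr \<gamma> = t"
        using \<open>t \<ge> 1\<close> by (simp flip: powr_add)
      also have "t \<le> 2 * n * t powr \<gamma>"
        using double[of t] far J_y \<open>t \<ge> 1\<close> by linarith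
      finally have "t powr (1 - \<gamma>) \<le> 2 * n"
        using \<open>t \<ge> 1\<close> by simp
      then have "(t powr (1 - \<gamma>)) powr (1 / (1 - \<gamma>)) \<le> K"
        unfolding K_def using assms by (intro powr_mono2) auto
      then have "t \<le> K"
        using \<open>t \<ge> 1\<close> assms by (simp add: powr_powr)
      also have "K * 1 \<le> K * ?J x powr \<gamma>"
        using K J assms by (intro mult_left_mono) auto
      finally show ?thesis
        by simp
    qed
  qed
  then show ?thesis
    by (simp add: t_def K_def)
qed

theorem theorem2p1:
  fixes a :: "int \<Rightarrow> int \<Rightarrow> complex" and n :: int and \<gamma> :: real
  assumes "hermitian a"
    and "n \<ge> 1" and "0 \<le> \<gamma>" and "\<gamma> < 1"
    and "\<And>x z :: int. real_of_int z > real_of_int n * jbracket (of_int x) powr \<gamma> \<Longrightarrow> a x (x + z) = 0"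
    and "((\<lambda>x :: int. 1 / jbracket (of_int x) powr (1 - \<gamma>) * (\<Sum>\<^sub>\<infinity>y. cmod (a x y))) \<longlongrightarrow> 0)
           (filtercomap abs at_top)"
  shows "essentially_self_adjoint (matrix_operator a)"
proof -
  define K where "K = (2 * real_of_int n) powr (1 / (1 - \<gamma>))"
  interpret banded_hermitian a K \<gamma>
  proof
    show "\<bar>real_of_int (x - y)\<bar> \<le> K * jbracket (of_int x) powr \<gamma>" if "a x y \<noteq> 0" for x y
      unfolding K_def by (rule symmetric_band_bound) (use assms that in auto)
    show "1 \<le> K"
      unfolding K_def using assms by (intro ge_one_powr_ge_zero) auto
    show "\<exists>N. \<forall>x. \<bar>x\<bar> \<ge> N \<longrightarrow> (\<Sum>\<^sub>\<infinity>y. cmod (a x y)) \<le> \<delta> * jbracket (of_int x) powr (1 - \<gamma>)"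
      if "\<delta> > 0" for \<delta>
    proof -
      \<comment> \<open>Clears the denominator of the limit hypothesis, which is positive as the
        bracket is at least 1.\<close>
      have *: "s \<le> \<delta> * jbracket (of_int x) powr (1 - \<gamma>)"
        if "1 / jbracket (of_int x) powr (1 - \<gamma>) * s < \<delta>" for s and x :: int
      proof -
        have "jbracket (of_int x) powr (1 - \<gamma>) > 0"
          using jbracket_ge_1[of "of_int x"] by simp
        then show ?thesis
          using that by (simp add: field_simps)
      qed
      show ?thesis
        using order_tendstoD(2)[OF assms(6) \<open>\<delta> > 0\<close>] *
        unfolding eventually_filtercomap_at_top_linorder by blast
    qed
  qed (fact assms)+
  show ?thesis
    by (rule essentially_self_adjointI[OF maximal_graph_subset_graph_closure])
qed

end
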